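(* Let $\mathcal{S}$ be a scale-invariant sigmoidal activation and let $$\Psi(\mathbf{x})=\sum_{l=1}^{D}\sigma_l\Big(\sum_{\{\alpha,s\}}A^{s_1}_{(1)\,\alpha_1\alpha_2}\cdots A^{l s_i}_{(i)\,\alpha_i\alpha_{i+1}}\cdots A^{s_n}_{(n)\,\alpha_n\alpha_1}\,\Phi^{s_1\cdots s_n}(\mathbf{x})\Big),\qquad \mathbf{x}\in\mathbb{R}^n,$$ be an activated MPS function with $\sigma_1,\dots,\sigma_D\in\mathcal{S}$ and kernel function $\Phi$. Then there exists an equivalent one-hidden-layer neural network with kernel function $\Phi$: that is, with $\Phi$ regarded as a map $\mathbb{R}^n\to\mathbb{R}^{N}$, $N=\prod_{j=1}^n d_j$, there are real weights $W_{[1]}^{ls}$ and $W_{[2]}^{l}$ ($1\le l\le D$, $1\le s\le N$) and activations $\tau_1,\dots,\tau_D\in\mathcal{S}$ such that the network $$\mathbf{x}\mapsto\sum_{l=1}^{D}W_{[2]}^{l}\,\tau_l\Big(\sum_{s=1}^{N}W_{[1]}^{ls}\,\Phi^{s}(\mathbf{x})\Big)$$ has the same output as $\Psi$ on every data set, i.e. both functions agree at every $\mathbf{x}\in\mathbb{R}^n$.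
   Context: Scale-invariant sigmoidal activation: a family $\mathcal{S}$ of functions $\sigma:\mathbb{R}\to\mathbb{R}$ such that (i) every $\sigma\in\mathcal{S}$ satisfies $\sigma(x)\to0$ as $x\to-\infty$ and $\sigma(x)\to C$ as $x\to+\infty$ for some real $C$ depending on $\sigma$; (ii) $C\neq0$ for at least one $\sigma\in\mathcal{S}$; (iii) $k\sigma\in\mathcal{S}$ for all $\sigma\in\mathcal{S}$ and $k\in\mathbb{R}$. In the activated MPS function: $n,D\ge1$ are integers; $i\in\{1,\dots,n\}$ is the one site carrying the extra index $l$; for each $j\in\{1,\dots,n\}$, $s_j$ ranges over $\{1,\dots,d_j\}$ and $\alpha_j$ over $\{1,\dots,D_j\}$ for integers $d_j,D_j\ge1$ (with $\alpha_{n+1}=\alpha_1$, $D_{n+1}=D_1$); for $j\neq i$, $A_{(j)}$ is a real tensor of size $d_j\times D_j\times D_{j+1}$, and $A_{(i)}$ is a real tensor of size $D\times d_i\times D_i\times D_{i+1}$. The inner sum is over all $\alpha_j,s_j$. The kernel function is $\Phi^{s_1\cdots s_n}(\mathbf{x})=\prod_{j=1}^n\phi_j^{s_j}(x_j)$ with maps $\phi_j:\mathbb{R}\to\mathbb{R}^{d_j}$; it is regarded as a map into $\mathbb{R}^N$, $N=\prod_j d_j$, by identifying the multi-index $(s_1,\dots,s_n)$ with a single index $s\in\{1,\dots,N\}$ via a fixed bijection. *)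

theory Defs
  imports Complex_Main "HOL-Library.FuncSet"
begin

definition scale_invariant_sigmoidal :: "(real \<Rightarrow> real) set \<Rightarrow> bool" where
  "scale_invariant_sigmoidal S \<longleftrightarrow>
     (\<forall>\<sigma>\<in>S. (\<sigma> \<longlongrightarrow> 0) at_bot \<and> (\<exists>C. (\<sigma> \<longlongrightarrow> C) at_top)) \<and>
     (\<exists>\<sigma>\<in>S. \<exists>C. C \<noteq> 0 \<and> (\<sigma> \<longlongrightarrow> C) at_top) \<and>
     (\<forall>\<sigma>\<in>S. \<forall>k. (\<lambda>x. k * \<sigma> x) \<in> S)"

text \<open>
  The space of real \<open>n\<close>-vectors, for a variable \<open>n\<close>, with coordinates indexed by \<open>{1..n}\<close>.
\<close>

definition real_vectors :: "nat \<Rightarrow> (nat \<Rightarrow> real) set" where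
  "real_vectors n = {1..n} \<rightarrow>\<^sub>E UNIV"

text \<open>
  All tuples \<open>(m 1, \<dots>, m n)\<close> with \<open>1 \<le> m j \<le> b j\<close>. Tuples are extensional functions, so that
  each one occurs exactly once in a sum over this finite set.
\<close>

definition multi_indices :: "nat \<Rightarrow> (nat \<Rightarrow> nat) \<Rightarrow> (nat \<Rightarrow> nat) set" where
  "multi_indices n b = (\<Pi>\<^sub>E j\<in>{1..n}. {1..b j})"

text \<open>
  The site following \<open>j\<close> on the ring of \<open>n\<close> sites; it encodes the convention that the index
  \<open>n + 1\<close> is identified with \<open>1\<close>.
\<close>

definition next_site :: "nat \<Rightarrow> nat \<Rightarrow> nat" where
  "next_site n j = (if j = n then 1 else j + 1)"

text \<open>The \<open>s\<close>-th coordinate of the \<open>j\<close>-th local feature map at \<open>t\<close> is \<open>\<phi> j t s\<close>.\<close>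

definition product_kernel :: "nat \<Rightarrow> (nat \<Rightarrow> real \<Rightarrow> nat \<Rightarrow> real) \<Rightarrow> (nat \<Rightarrow> nat) \<Rightarrow> (nat \<Rightarrow> real) \<Rightarrow> real" where
  "product_kernel n \<phi> s x = (\<Prod>j\<in>{1..n}. \<phi> j (x j) (s j))"

text \<open>
  The tensor at a site \<open>j \<noteq> i\<close> has entries \<open>A j s \<alpha> \<beta>\<close>, and the one at site \<open>i\<close>, which carries
  the additional index \<open>l\<close>, has entries \<open>B l s \<alpha> \<beta>\<close>. The physical dimensions are \<open>d j\<close> and the
  bond dimensions \<open>b j\<close>. The values \<open>A i\<close>, and entries of \<open>A\<close> and \<open>B\<close> with indices out of
  range, are never used.
\<close>

definition mps_coeff ::
  "nat \<Rightarrow> nat \<Rightarrow> (nat \<Rightarrow> nat \<Rightarrow> nat \<Rightarrow> nat \<Rightarrow> real) \<Rightarrow> (nat \<Rightarrow> nat \<Rightarrow> nat \<Rightarrow> nat \<Rightarrow> real) \<Rightarrow>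
   nat \<Rightarrow> (nat \<Rightarrow> nat) \<Rightarrow> (nat \<Rightarrow> nat) \<Rightarrow> real" where
  "mps_coeff n i A B l \<alpha> s =
     (\<Prod>j\<in>{1..n}. if j = i then B l (s j) (\<alpha> j) (\<alpha> (next_site n j))
                  else A j (s j) (\<alpha> j) (\<alpha> (next_site n j)))"

definition activated_mps ::
  "nat \<Rightarrow> nat \<Rightarrow> nat \<Rightarrow> (nat \<Rightarrow> nat) \<Rightarrow> (nat \<Rightarrow> nat) \<Rightarrow>
   (nat \<Rightarrow> nat \<Rightarrow> nat \<Rightarrow> nat \<Rightarrow> real) \<Rightarrow> (nat \<Rightarrow> nat \<Rightarrow> nat \<Rightarrow> nat \<Rightarrow> real) \<Rightarrow>
   (nat \<Rightarrow> real \<Rightarrow> real) \<Rightarrow> ((nat \<Rightarrow> nat) \<Rightarrow> (nat \<Rightarrow> real) \<Rightarrow> real) \<Rightarrow> (nat \<Rightarrow> real) \<Rightarrow> real" where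
  "activated_mps n D i d b A B \<sigma> \<Phi> x =
     (\<Sum>l=1..D. \<sigma> l (\<Sum>\<alpha>\<in>multi_indices n b. \<Sum>s\<in>multi_indices n d.
        mps_coeff n i A B l \<alpha> s * \<Phi> s x))"

text \<open>
  A kernel indexed by tuples, reindexed by single numbers along an enumeration \<open>e\<close> of the tuples.
\<close>

definition flatten_kernel ::
  "nat \<Rightarrow> (nat \<Rightarrow> nat) \<Rightarrow> ((nat \<Rightarrow> nat) \<Rightarrow> nat) \<Rightarrow> ((nat \<Rightarrow> nat) \<Rightarrow> (nat \<Rightarrow> real) \<Rightarrow> real) \<Rightarrow>
   nat \<Rightarrow> (nat \<Rightarrow> real) \<Rightarrow> real" where
  "flatten_kernel n d e \<Phi> s = \<Phi> (inv_into (multi_indices n d) e s)"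

definition one_hidden_layer_network ::
  "nat \<Rightarrow> nat \<Rightarrow> (nat \<Rightarrow> nat \<Rightarrow> real) \<Rightarrow> (nat \<Rightarrow> real) \<Rightarrow> (nat \<Rightarrow> real \<Rightarrow> real) \<Rightarrow>
   (nat \<Rightarrow> (nat \<Rightarrow> real) \<Rightarrow> real) \<Rightarrow> (nat \<Rightarrow> real) \<Rightarrow> real" where
  "one_hidden_layer_network D N W1 W2 \<tau> \<Phi> x =
     (\<Sum>l=1..D. W2 l * \<tau> l (\<Sum>s=1..N. W1 l s * \<Phi> s x))"

end

theory Submission
  imports Defs
begin

text \<open>The argument of each \<sigma>_l is linear in the kernel values. Contracting the bond
  indices \<alpha> around the ring leaves, for every l and s, a number independent of x: the trace
  of the product of the site matrices selected by l and s. These traces are the first-layer weights,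
  written along the enumeration \<open>e\<close> of the tuples s. With output weights 1 and the
  activations \<sigma>_l unchanged, the two functions then agree term by term in l.\<close>

lemma activated_mps_eq_one_hidden_layer_network:
  assumes "bij_betw e (multi_indices n d) {1..N}"
  shows "activated_mps n D i d b A B \<sigma> \<Phi> x =
    one_hidden_layer_network D N
      (\<lambda>l k. \<Sum>\<alpha>\<in>multi_indices n b. mps_coeff n i A B l \<alpha> (inv_into (multi_indices n d) e k))
      (\<lambda>l. 1) \<sigma> (flatten_kernel n d e \<Phi>) x"
proof -
  let ?g = "inv_into (multi_indices n d) e"
  have "(\<Sum>\<alpha>\<in>multi_indices n b. \<Sum>s\<in>multi_indices n d. mps_coeff n i A B l \<alpha> s * \<Phi> s x) =
    (\<Sum>k=1..N. (\<Sum>\<alpha>\<in>multi_indices n b. mps_coeff n i A B l \<alpha> (?g k)) * \<Phi> (?g k) x)" for l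
  proof -
    have "(\<Sum>\<alpha>\<in>multi_indices n b. \<Sum>s\<in>multi_indices n d. mps_coeff n i A B l \<alpha> s * \<Phi> s x) =
      (\<Sum>s\<in>multi_indices n d. (\<Sum>\<alpha>\<in>multi_indices n b. mps_coeff n i A B l \<alpha> s) * \<Phi> s x)"
      \<comment> \<open>With s outermost, \<open>\<Phi> s x\<close> is constant in \<alpha> and
        factors out of the bond sum.\<close>
      by (subst sum.swap) (simp add: sum_distrib_right)
    also have "\<dots> =
      (\<Sum>k=1..N. (\<Sum>\<alpha>\<in>multi_indices n b. mps_coeff n i A B l \<alpha> (?g k)) * \<Phi> (?g k) x)"
      \<comment> \<open>The inverse of \<open>e\<close> maps \<open>{1..N}\<close> bijectively onto
        the tuples, so the substitution s = \<open>?g k\<close> meets each tuple once.\<close>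
      by (rule sum.reindex_bij_betw[OF bij_betw_inv_into[OF assms], symmetric])
    finally show ?thesis .
  qed
  then show ?thesis
    by (simp add: activated_mps_def one_hidden_layer_network_def flatten_kernel_def)
qed

theorem theorem3p5:
  fixes S :: "(real \<Rightarrow> real) set"
    and n D i N :: nat
    and d b :: "nat \<Rightarrow> nat"
    and A B :: "nat \<Rightarrow> nat \<Rightarrow> nat \<Rightarrow> nat \<Rightarrow> real"
    and \<sigma> :: "nat \<Rightarrow> real \<Rightarrow> real"
    and \<phi> :: "nat \<Rightarrow> real \<Rightarrow> nat \<Rightarrow> real"
    and e :: "(nat \<Rightarrow> nat) \<Rightarrow> nat"
  assumes "scale_invariant_sigmoidal S"
    and "n \<ge> 1" and "D \<ge> 1" and "i \<in> {1..n}"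
    and "\<And>j. j \<in> {1..n} \<Longrightarrow> d j \<ge> 1"
    and "\<And>j. j \<in> {1..n} \<Longrightarrow> b j \<ge> 1"
    and "\<And>l. l \<in> {1..D} \<Longrightarrow> \<sigma> l \<in> S"
    and "N = (\<Prod>j\<in>{1..n}. d j)"
    and "bij_betw e (multi_indices n d) {1..N}"
  shows "\<exists>W1 W2 \<tau>. (\<forall>l\<in>{1..D}. \<tau> l \<in> S) \<and>
           (\<forall>x\<in>real_vectors n.
              one_hidden_layer_network D N W1 W2 \<tau> (flatten_kernel n d e (product_kernel n \<phi>)) x =
              activated_mps n D i d b A B \<sigma> (product_kernel n \<phi>) x)"
  \<comment> \<open>The witnesses come from the lemma: its weights, and \<tau> = \<sigma>, which
    lies in \<open>S\<close> by \<open>assms(7)\<close>.\<close>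
  using assms(7) activated_mps_eq_one_hidden_layer_network[OF assms(9), symmetric] by blast

end
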